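(* Let $S$ be a finite set of candidate jurors, where juror $j_i \in S$ has individual error rate $\epsilon_i \in (0,1)$, and let $n$ be an odd integer with $1 \le n \le |S|$. Let $J^* \subseteq S$ be a set of $n$ jurors with the lowest individual error rates, i.e. $|J^*| = n$ and $\epsilon_i \le \epsilon_k$ whenever $j_i \in J^*$ and $j_k \in S \setminus J^*$. Then $JER(J^* ) \le JER(J)$ for every jury $J \subseteq S$ with $|J| = n$.
   Context: A jury is a subset $J$ of $S$ of odd size $n$. Individual error rate $\epsilon_i$ is the probability that juror $j_i$ votes wrongly; jurors err independently. The jury error rate under majority voting is the probability that at least $\frac{n+1}{2}$ of the jurors in $J$ vote wrongly: $$JER(J) = \sum_{k=\frac{n+1}{2}}^{n} \ \sum_{A \subseteq J,\ |A| = k} \ \prod_{j_i \in A} \epsilon_i \prod_{j_i \in J\setminus A} (1-\epsilon_i).$$ *)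

theory Defs
  imports Complex_Main
begin

text \<open>
  Jurors are elements of a type \<open>'a\<close>, and \<open>\<epsilon> j\<close> is the probability that juror \<open>j\<close> votes wrongly.
  The set \<open>A\<close> ranges over the possible sets of jurors who vote wrongly; the products are the
  probabilities of these outcomes when the jurors err independently. The value is meaningful for
  finite \<open>J\<close> of odd size, for which \<open>div\<close> is exact division.
\<close>

definition JER :: "('a \<Rightarrow> real) \<Rightarrow> 'a set \<Rightarrow> real" where
  "JER \<epsilon> J =
     (\<Sum>k = (card J + 1) div 2..card J.
        \<Sum>A\<in>{A. A \<subseteq> J \<and> card A = k}.
          (\<Prod>j\<in>A. \<epsilon> j) * (\<Prod>j\<in>J - A. 1 - \<epsilon> j))"

end

theory Submission
  imports Defs
begin

text \<open>
  Conditioning on the vote of one juror \<open>x\<close> shows that the probability of at least \<open>t + 1\<close> wrong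
  votes is affine in \<open>\<epsilon> x\<close>, with slope the probability that exactly \<open>t\<close> of the other jurors vote
  wrongly. Hence replacing a juror by one with a lower error rate does not increase the jury error
  rate. Any jury is turned into the optimal one by finitely many such exchanges, each replacing a
  juror outside the optimal jury by one inside it.
\<close>

definition wrong_weight :: "('a \<Rightarrow> real) \<Rightarrow> 'a set \<Rightarrow> 'a set \<Rightarrow> real" where
  "wrong_weight \<epsilon> J A = (\<Prod>j\<in>A. \<epsilon> j) * (\<Prod>j\<in>J - A. 1 - \<epsilon> j)"

text \<open>The threshold \<open>t\<close> is a parameter of its own, not tied to
  \<open>card J\<close>, because conditioning on a juror changes the jury and the number of wrong
  votes still required separately.\<close>

definition wrong_tail :: "('a \<Rightarrow> real) \<Rightarrow> 'a set \<Rightarrow> nat \<Rightarrow> real" where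
  "wrong_tail \<epsilon> J t = (\<Sum>A | A \<subseteq> J \<and> t \<le> card A. wrong_weight \<epsilon> J A)"

lemma wrong_weight_nonneg:
  assumes "A \<subseteq> J" "\<And>j. j \<in> J \<Longrightarrow> 0 \<le> \<epsilon> j \<and> \<epsilon> j \<le> 1"
  shows "0 \<le> wrong_weight \<epsilon> J A"
  unfolding wrong_weight_def using assms by (intro mult_nonneg_nonneg prod_nonneg) auto

lemma wrong_tail_antimono:
  assumes "finite J" "\<And>j. j \<in> J \<Longrightarrow> 0 \<le> \<epsilon> j \<and> \<epsilon> j \<le> 1" "s \<le> t"
  shows "wrong_tail \<epsilon> J t \<le> wrong_tail \<epsilon> J s"
  unfolding wrong_tail_def using assms
  by (intro sum_mono2 wrong_weight_nonneg) auto

text \<open>Grouping the sets of wrong voters by cardinality turns the single sum into the double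
  one; finiteness of \<open>J\<close> bounds these cardinalities by \<open>card J\<close>.\<close>

lemma JER_eq_wrong_tail:
  assumes "finite J"
  shows "JER \<epsilon> J = wrong_tail \<epsilon> J ((card J + 1) div 2)"
proof -
  let ?m = "(card J + 1) div 2"
  let ?B = "{A. A \<subseteq> J \<and> ?m \<le> card A}"
  have "wrong_tail \<epsilon> J ?m = (\<Sum>k = ?m..card J. \<Sum>A | A \<in> ?B \<and> card A = k. wrong_weight \<epsilon> J A)"
    unfolding wrong_tail_def using assms
    by (intro sum.group[symmetric]) (auto intro: card_mono)
  also have "\<dots> = JER \<epsilon> J"
    unfolding JER_def wrong_weight_def by (intro sum.cong) auto
  finally show ?thesis ..
qed

text \<open>Law of total probability over the vote of \<open>x\<close>: if \<open>x\<close> errs,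
  \<open>t\<close> wrong votes from \<open>J\<close> suffice; otherwise \<open>J\<close> must supply
  all \<open>Suc t\<close>.\<close>

lemma wrong_tail_insert:
  assumes "finite J" "x \<notin> J"
  shows "wrong_tail \<epsilon> (insert x J) (Suc t) =
    \<epsilon> x * wrong_tail \<epsilon> J t + (1 - \<epsilon> x) * wrong_tail \<epsilon> J (Suc t)"
proof -
  let ?B = "\<lambda>s. {A. A \<subseteq> J \<and> s \<le> card A}"
  have card: "card (insert x A) = Suc (card A)" if "A \<subseteq> J" for A
    using that assms finite_subset[OF that] by (subst card_insert_disjoint) auto
  \<comment> \<open>The first part collects the sets containing \<open>x\<close>, the second those
    avoiding it.\<close>
  have split: "{A. A \<subseteq> insert x J \<and> Suc t \<le> card A} = insert x ` ?B t \<union> ?B (Suc t)"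
    (is "?L = ?R")
  proof
    show "?L \<subseteq> ?R"
    proof
      fix A assume A: "A \<in> ?L"
      show "A \<in> ?R"
      proof (cases "x \<in> A")
        case True
        then have "A = insert x (A - {x})" "A - {x} \<subseteq> J" using A by auto
        moreover from this have "card A = Suc (card (A - {x}))" using card by metis
        ultimately show ?thesis using A by (intro UnI1 image_eqI[of _ _ "A - {x}"]) simp_all
      qed (use A in auto)
    qed
    show "?R \<subseteq> ?L" using card by auto
  qed
  have inj: "inj_on (insert x) (?B t)"
    using assms(2) by (auto simp: inj_on_def)
  have wrong: "wrong_weight \<epsilon> (insert x J) (insert x A) = \<epsilon> x * wrong_weight \<epsilon> J A"
    if "A \<subseteq> J" for A
  proof -
    have "insert x J - insert x A = J - A" using assms(2) by auto
    moreover have "finite A" "x \<notin> A" using that assms finite_subset by auto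
    ultimately show ?thesis by (simp add: wrong_weight_def)
  qed
  have right: "wrong_weight \<epsilon> (insert x J) A = (1 - \<epsilon> x) * wrong_weight \<epsilon> J A"
    if "A \<subseteq> J" for A
  proof -
    have "insert x J - A = insert x (J - A)" using that assms(2) by auto
    then show ?thesis using assms by (simp add: wrong_weight_def)
  qed
  have "wrong_tail \<epsilon> (insert x J) (Suc t) =
      (\<Sum>A\<in>insert x ` ?B t. wrong_weight \<epsilon> (insert x J) A) +
      (\<Sum>A\<in>?B (Suc t). wrong_weight \<epsilon> (insert x J) A)"
    unfolding wrong_tail_def split using assms by (intro sum.union_disjoint) auto
  also have "\<dots> = (\<Sum>A\<in>?B t. \<epsilon> x * wrong_weight \<epsilon> J A) +
      (\<Sum>A\<in>?B (Suc t). (1 - \<epsilon> x) * wrong_weight \<epsilon> J A)"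
    using wrong right by (simp add: sum.reindex[OF inj])
  finally show ?thesis by (simp add: wrong_tail_def sum_distrib_left)
qed

text \<open>The two juries share \<open>J\<close>, so their error rates are values of one affine
  function at \<open>\<epsilon> x\<close> and \<open>\<epsilon> y\<close>. Its slope is a difference
  of consecutive tails, hence nonnegative.\<close>

lemma JER_exchange:
  assumes "finite J" "\<And>j. j \<in> J \<Longrightarrow> 0 \<le> \<epsilon> j \<and> \<epsilon> j \<le> 1"
    and "x \<notin> J" "y \<notin> J" "\<epsilon> x \<le> \<epsilon> y"
  shows "JER \<epsilon> (insert x J) \<le> JER \<epsilon> (insert y J)"
proof -
  \<comment> \<open>The enlarged jury has \<open>card J + 1\<close> members, so its majority
    threshold is \<open>(card J + 2) div 2 = Suc t\<close>.\<close>
  define t where "t = card J div 2"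
  have J: "JER \<epsilon> (insert z J) =
      wrong_tail \<epsilon> J (Suc t) + \<epsilon> z * (wrong_tail \<epsilon> J t - wrong_tail \<epsilon> J (Suc t))"
    if "z \<notin> J" for z
    using assms(1) that
    by (simp add: JER_eq_wrong_tail wrong_tail_insert t_def algebra_simps)
  have "wrong_tail \<epsilon> J (Suc t) \<le> wrong_tail \<epsilon> J t"
    using assms(1,2) by (intro wrong_tail_antimono) auto
  then show ?thesis
    using assms(3-5) by (simp add: J mult_right_mono)
qed

theorem lemma3:
  fixes S :: "'a set" and \<epsilon> :: "'a \<Rightarrow> real" and n :: nat and Jstar :: "'a set"
  assumes "finite S"
    and "\<forall>j\<in>S. 0 < \<epsilon> j \<and> \<epsilon> j < 1"
    and "odd n" and "1 \<le> n" and "n \<le> card S"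
    and "Jstar \<subseteq> S" and "card Jstar = n"
    and "\<forall>i\<in>Jstar. \<forall>k\<in>S - Jstar. \<epsilon> i \<le> \<epsilon> k"
  shows "\<forall>J. J \<subseteq> S \<and> card J = n \<longrightarrow> JER \<epsilon> Jstar \<le> JER \<epsilon> J"
proof (intro allI impI)
  fix J assume "J \<subseteq> S \<and> card J = n"
  then show "JER \<epsilon> Jstar \<le> JER \<epsilon> J"
  \<comment> \<open>The measure counts the members of \<open>J\<close> still to be
    exchanged.\<close>
  proof (induction "card (J - Jstar)" arbitrary: J rule: less_induct)
    case less
    have fin: "finite J" "finite Jstar"
      using less.prems assms(1,6) finite_subset by auto
    show ?case
    proof (cases "J = Jstar")
      case False
      \<comment> \<open>Distinct finite sets of equal size cannot include one another, so each has a
        member that the other lacks.\<close>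
      have "\<not> J \<subseteq> Jstar" "\<not> Jstar \<subseteq> J"
        using False fin less.prems assms(7) card_subset_eq by metis+
      then obtain x y where x: "x \<in> Jstar" "x \<notin> J" and y: "y \<in> J" "y \<notin> Jstar"
        by auto
      define K where "K = J - {y}"
      have J: "J = insert y K" and K: "finite K" "x \<notin> K" "y \<notin> K" "K \<subseteq> S"
        using x y fin less.prems by (auto simp: K_def)
      \<comment> \<open>The exchange removes \<open>y\<close> from the difference, and
        \<open>x\<close> adds nothing because it lies in \<open>Jstar\<close>.\<close>
      have "insert x K - Jstar \<subset> J - Jstar"
        using x y by (auto simp: K_def)
      then have "card (insert x K - Jstar) < card (J - Jstar)"
        using fin by (simp add: psubset_card_mono)
      moreover have "insert x K \<subseteq> S \<and> card (insert x K) = n"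
        using J K x assms(6) less.prems by auto
      ultimately have "JER \<epsilon> Jstar \<le> JER \<epsilon> (insert x K)"
        by (rule less.hyps)
      also have "\<dots> \<le> JER \<epsilon> (insert y K)"
      proof (rule JER_exchange)
        \<comment> \<open>Optimality of \<open>Jstar\<close> applies since \<open>y\<close> is a
          candidate outside it.\<close>
        show "\<epsilon> x \<le> \<epsilon> y" using assms(8) x y less.prems by blast
        show "0 \<le> \<epsilon> j \<and> \<epsilon> j \<le> 1" if "j \<in> K" for j
          using that K(4) assms(2) by (meson less_imp_le subsetD)
      qed (use K in auto)
      finally show ?thesis by (simp add: J)
    qed simp
  qed
qed

end
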